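(* Let $T$ be a tree with $n\ge 3$ vertices. Then $s^*(T)\le 2n-2-L(T)$. Moreover, this bound holds with equality when $T$ is a star.
   Context: For a tree $T$ and vertex $u$, $L(u)$ denotes the set of leaves adjacent to $u$, and $L(T)=\max\{|L(u)|: u\in V(T)\}$. For a graph $G$ and vertex $v$, $N[v]=\{v\}\cup\{u: uv\in E(G)\}$. For a labeling $f:V(G)\to\{1,2,\dots\}$ let $s^*_f(v)=\sum_{x\in N[v]}f(x)$; the labeling is vertex sum-distinguishing if $s^*_f(u)\ne s^*_f(v)$ whenever $N[u]\ne N[v]$. $s^*(G)$ is the smallest $k$ such that $G$ has a vertex sum-distinguishing labeling with labels in $\{1,\dots,k\}$. *)

theory Defs
  imports "Graph_Theory.Graph_Theory" "HOL-Library.Nat_Bijection"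
begin

text \<open>
  Finite simple graphs are the symmetric, loop-free digraphs without parallel arcs of the locale
  \<^locale>\<open>graph\<close>; an undirected edge \<open>uv\<close> is the pair of arcs \<open>(u, v)\<close>, \<open>(v, u)\<close>.

  The library's \<^const>\<open>tree\<close> forbids directed cycles. In a symmetric digraph every edge gives a
  directed cycle of length 2, so that notion is not the undirected one. As a \<^const>\<open>pre_digraph.cycle\<close>
  does not repeat vertices, those of length at least 3 are exactly the cycles of the undirected graph.
\<close>

definition undirected_tree :: "('a, 'b) pre_digraph \<Rightarrow> bool" where
  "undirected_tree G \<longleftrightarrow>
     graph G \<and> connected G \<and> \<not> (\<exists>p. pre_digraph.cycle G p \<and> 3 \<le> length p)"

definition star :: "('a, 'b) pre_digraph \<Rightarrow> bool" where
  "star G \<longleftrightarrow> (\<exists>m. complete_bipartite_digraph 1 m G)"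

text \<open>In a symmetric digraph the out-degree of a vertex is its degree in the undirected graph.\<close>

definition leaves_at :: "('a, 'b) pre_digraph \<Rightarrow> 'a \<Rightarrow> 'a set" where
  "leaves_at G u = {v \<in> verts G. out_degree G v = 1 \<and> u \<rightarrow>\<^bsub>G\<^esub> v}"

definition max_leaves_at :: "('a, 'b) pre_digraph \<Rightarrow> nat" where
  "max_leaves_at G = Max ((\<lambda>u. card (leaves_at G u)) ` verts G)"

definition closed_nbhd :: "('a, 'b) pre_digraph \<Rightarrow> 'a \<Rightarrow> 'a set" where
  "closed_nbhd G v = {v} \<union> {u. v \<rightarrow>\<^bsub>G\<^esub> u}"

definition vertex_sum :: "('a, 'b) pre_digraph \<Rightarrow> ('a \<Rightarrow> nat) \<Rightarrow> 'a \<Rightarrow> nat" where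
  "vertex_sum G f v = (\<Sum>x\<in>closed_nbhd G v. f x)"

definition vertex_sum_distinguishing :: "('a, 'b) pre_digraph \<Rightarrow> ('a \<Rightarrow> nat) \<Rightarrow> bool" where
  "vertex_sum_distinguishing G f \<longleftrightarrow>
     (\<forall>u\<in>verts G. \<forall>v\<in>verts G.
        closed_nbhd G u \<noteq> closed_nbhd G v \<longrightarrow> vertex_sum G f u \<noteq> vertex_sum G f v)"

text \<open>
  A labelling is a total function of which only the values on the vertices matter.
\<close>

definition vertex_sum_number :: "('a, 'b) pre_digraph \<Rightarrow> nat" where
  "vertex_sum_number G =
     (LEAST k. \<exists>f. f ` verts G \<subseteq> {1..k} \<and> vertex_sum_distinguishing G f)"

text \<open>The minimum is attained: labelling the vertices with distinct powers of 2 works.\<close>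

lemma ex_vertex_sum_distinguishing:
  assumes "graph G"
  shows "\<exists>k f. f ` verts G \<subseteq> {1..k} \<and> vertex_sum_distinguishing G f"
proof -
  interpret graph G by fact
  obtain g :: "'a \<Rightarrow> nat" where g: "inj_on g (verts G)"
    using finite_imp_inj_to_nat_seg[OF finite_verts] by metis
  define f where "f v = (2::nat) ^ g v" for v
  have sub: "closed_nbhd G v \<subseteq> verts G" if "v \<in> verts G" for v
    using that by (auto simp: closed_nbhd_def)
  have sum: "vertex_sum G f v = set_encode (g ` closed_nbhd G v)" if "v \<in> verts G" for v
    using inj_on_subset[OF g sub[OF that]]
    by (simp add: vertex_sum_def f_def set_encode_def sum.reindex)
  have "vertex_sum_distinguishing G f"
    unfolding vertex_sum_distinguishing_def
  proof (intro ballI impI notI)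
    fix u v assume uv: "u \<in> verts G" "v \<in> verts G" "closed_nbhd G u \<noteq> closed_nbhd G v"
      and "vertex_sum G f u = vertex_sum G f v"
    moreover have "finite (g ` closed_nbhd G w)" if "w \<in> verts G" for w
      using sub[OF that] finite_verts by (meson finite_imageI finite_subset)
    ultimately have "g ` closed_nbhd G u = g ` closed_nbhd G v"
      by (simp add: sum set_encode_eq)
    with uv show False
      using inj_on_image_eq_iff[OF g sub sub] by blast
  qed
  moreover have "f ` verts G \<subseteq> {1..Max (f ` verts G)}"
    by (auto simp: f_def)
  ultimately show ?thesis by blast
qed

end

theory Submission
  imports Defs
begin

text \<open>
  Fix a vertex \<open>u\<close> and label the vertices of the tree greedily, in an order that starts at \<open>u\<close>,
  keeps the set of labelled vertices connected, and treats the leaves at \<open>u\<close> last. As there are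
  no cycles, a new vertex \<open>x\<close> has a single labelled neighbour \<open>p\<close>, so its label completes at most
  the sums of \<open>x\<close> and \<open>p\<close>. Each of these has to avoid the sums completed before, except that the
  sum of \<open>p\<close> automatically exceeds the sums of \<open>x\<close> and of the leaves at \<open>p\<close>. This excludes at most
  \<open>2 n - 3 - |L(u)|\<close> labels in every step. Conversely, leaves at the same vertex need
  distinct labels, and in a star all vertices but one are such leaves.
\<close>

text \<open>The vertices whose sum is determined by the labels on \<open>S\<close>.\<close>

definition settled :: "('a, 'b) pre_digraph \<Rightarrow> 'a set \<Rightarrow> 'a set" where
  "settled G S = {v. closed_nbhd G v \<subseteq> S}"

text \<open>Connectedness of the subgraph induced on \<open>S\<close>, phrased with explicit paths
  because these are later closed up to cycles.\<close>

definition joined :: "('a, 'b) pre_digraph \<Rightarrow> 'a set \<Rightarrow> bool" where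
  "joined G S \<longleftrightarrow>
     (\<forall>p\<in>S. \<forall>q\<in>S. \<exists>w. pre_digraph.apath G p w q \<and> set (pre_digraph.awalk_verts G p w) \<subseteq> S)"

section \<open>Closed neighbourhoods, leaves and connectedness\<close>

lemma mem_closed_nbhd_iff: "w \<in> closed_nbhd G v \<longleftrightarrow> w = v \<or> v \<rightarrow>\<^bsub>G\<^esub> w"
  by (auto simp: closed_nbhd_def)

lemma settled_subset: "settled G S \<subseteq> S"
  by (auto simp: settled_def closed_nbhd_def)

context graph
begin

lemma adj_sym: "v \<rightarrow> w \<Longrightarrow> w \<rightarrow> v"
  using arcs_ends_symmetric[OF sym_arcs] by blast

lemma adj_irrefl: "\<not> v \<rightarrow> v"
  using no_loops by (auto simp: arcs_ends_conv)

lemma closed_nbhd_subset_verts: "v \<in> verts G \<Longrightarrow> closed_nbhd G v \<subseteq> verts G"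
  by (auto simp: closed_nbhd_def)

lemma finite_closed_nbhd: "finite (closed_nbhd G v)"
proof -
  have "closed_nbhd G v \<subseteq> insert v (verts G)"
    by (auto simp: closed_nbhd_def)
  then show ?thesis
    by (rule finite_subset) simp
qed

lemma finite_leaves_at: "finite (leaves_at G u)"
  by (simp add: leaves_at_def)

lemma settled_verts: "settled G (verts G) = verts G"
  using settled_subset[of G "verts G"] closed_nbhd_subset_verts by (auto simp: settled_def)

lemma out_degree_conv_adj: "out_degree G v = card {w. v \<rightarrow> w}"
proof -
  have "inj_on (head G) (out_arcs G v)"
    by (rule inj_onI) (auto simp: out_arcs_def arc_to_ends_def intro: no_multi_arcs)
  moreover have "head G ` out_arcs G v = {w. v \<rightarrow> w}"
    by (auto simp: out_arcs_def arcs_ends_conv)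
  ultimately show ?thesis
    by (metis card_image out_degree_def)
qed

lemma adj_leaf_iff:
  assumes "v \<in> leaves_at G u"
  shows "v \<rightarrow> w \<longleftrightarrow> w = u"
proof -
  have "card {w. v \<rightarrow> w} = 1" "v \<rightarrow> u"
    using assms adj_sym by (auto simp: leaves_at_def out_degree_conv_adj)
  then show ?thesis
    by (metis card_1_singletonE mem_Collect_eq singletonD)
qed

lemma closed_nbhd_leaf: "v \<in> leaves_at G u \<Longrightarrow> closed_nbhd G v = {v, u}"
  by (auto simp: closed_nbhd_def adj_leaf_iff)

lemma vertex_not_in_leaves_at: "u \<notin> leaves_at G u"
  using adj_irrefl by (auto simp: leaves_at_def)

text \<open>Positivity of the labels separates nested neighbourhoods without excluding any
  label.\<close>

lemma vertex_sum_less: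
  assumes "\<And>x. 0 < f x" "closed_nbhd G v \<subset> closed_nbhd G w"
  shows "vertex_sum G f v < vertex_sum G f w"
proof -
  obtain x where "x \<in> closed_nbhd G w - closed_nbhd G v"
    using assms(2) by blast
  then show ?thesis
    unfolding vertex_sum_def
    using assms finite_closed_nbhd by (intro sum_strict_mono2[of _ _ x]) auto
qed

text \<open>Connectedness as an induction principle: read contrapositively, it yields an edge that
  leaves a proper subset of the vertices.\<close>

lemma verts_subset_if_closed:
  assumes "connected G" "u \<in> C" "u \<in> verts G" "\<And>v w. v \<in> C \<Longrightarrow> v \<rightarrow> w \<Longrightarrow> w \<in> C"
  shows "verts G \<subseteq> C"
proof
  fix v assume "v \<in> verts G"
  then have "u \<rightarrow>\<^sup>* v"
    using assms(1,3) by (auto simp: connected_def strongly_connected_def reachable_mk_symmetric_eq[OF sym_arcs])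
  then show "v \<in> C"
    using assms(2,4) by (induction rule: reachable_induct) auto
qed

section \<open>Growing a connected vertex set in a tree\<close>

lemma joined_singleton: "u \<in> verts G \<Longrightarrow> joined G {u}"
  by (auto simp: joined_def apath_Nil_iff intro!: exI[of _ "[]"])

text \<open>Paths ending or starting at \<open>p\<close> are prolonged by the edge between
  \<open>p\<close> and \<open>x\<close>; no vertex repeats because \<open>x\<close> is outside
  \<open>S\<close>.\<close>

lemma joined_insert:
  assumes "joined G S" "p \<in> S" "x \<notin> S" "p \<rightarrow> x"
  shows "joined G (insert x S)"
proof -
  obtain e where e: "e \<in> arcs G" "tail G e = p" "head G e = x"
    using assms(4) by (auto simp: arcs_ends_conv)
  obtain e' where e': "e' \<in> arcs G" "tail G e' = x" "head G e' = p"
    using adj_sym[OF assms(4)] by (auto simp: arcs_ends_conv)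
  have to: "\<exists>w. apath x w q \<and> set (awalk_verts x w) \<subseteq> insert x S" if q: "q \<in> S" for q
  proof -
    obtain w where "apath p w q" "set (awalk_verts p w) \<subseteq> S"
      using assms(1,2) q unfolding joined_def by meson
    then show ?thesis
      using e' assms(3) by (intro exI[of _ "e' # w"]) (simp add: apath_Cons_iff, blast)
  qed
  have from_: "\<exists>w. apath q w x \<and> set (awalk_verts q w) \<subseteq> insert x S" if q: "q \<in> S" for q
  proof -
    obtain w where w: "apath q w p" "set (awalk_verts q w) \<subseteq> S"
      using assms(1,2) q unfolding joined_def by meson
    then have "awalk q (w @ [e]) x"
      using e by (auto simp: apath_def awalk_simps)
    moreover have "awalk_verts q (w @ [e]) = awalk_verts q w @ [x]"
      using calculation w e by (auto simp: apath_def awalk_verts_append)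
    ultimately show ?thesis
      using w assms(3) by (intro exI[of _ "w @ [e]"]) (auto simp: apath_def)
  qed
  have "apath x [] x"
    using e by (auto simp: apath_Nil_iff)
  then have refl: "\<exists>w. apath x w x \<and> set (awalk_verts x w) \<subseteq> insert x S"
    by (intro exI[of _ "[]"]) auto
  show ?thesis
    unfolding joined_def
  proof (intro ballI)
    fix q r assume "q \<in> insert x S" "r \<in> insert x S"
    then consider "q = x" "r = x" | "q = x" "r \<in> S" | "q \<in> S" "r = x" | "q \<in> S" "r \<in> S"
      by blast
    then show "\<exists>w. apath q w r \<and> set (awalk_verts q w) \<subseteq> insert x S"
    proof cases
      case 4
      then show ?thesis
        using assms(1) unfolding joined_def by blast
    qed (use to from_ refl in auto)
  qed
qed

text \<open>Two different neighbours of \<open>x\<close> would be joined by a path inside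
  \<open>S\<close>, which avoids \<open>x\<close> and hence closes to a cycle through
  \<open>x\<close>.\<close>

lemma unique_neighbour_in_joined:
  assumes "undirected_tree G" "joined G S" "x \<notin> S" "p \<in> S" "q \<in> S" "x \<rightarrow> p" "x \<rightarrow> q"
  shows "p = q"
proof (rule ccontr)
  assume "p \<noteq> q"
  obtain w where w: "apath p w q" "set (awalk_verts p w) \<subseteq> S"
    using assms(2,4,5) unfolding joined_def by meson
  obtain e where e: "e \<in> arcs G" "tail G e = x" "head G e = p"
    using assms(6) by (auto simp: arcs_ends_conv)
  obtain e' where e': "e' \<in> arcs G" "tail G e' = q" "head G e' = x"
    using adj_sym[OF assms(7)] by (auto simp: arcs_ends_conv)
  have "w \<noteq> []"
    using w \<open>p \<noteq> q\<close> by (auto simp: apath_def awalk_simps)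
  have aw: "awalk p (w @ [e']) x"
    using w e' by (auto simp: apath_def awalk_simps)
  then have "awalk_verts p (w @ [e']) = awalk_verts p w @ [x]"
    using w e' by (auto simp: apath_def awalk_verts_append)
  then have "cycle (e # w @ [e'])"
    unfolding cycle_def using aw e w assms(3)
    by (intro exI[of _ x]) (auto simp: awalk_Cons_iff apath_def)
  moreover have "3 \<le> length (e # w @ [e'])"
    using \<open>w \<noteq> []\<close> by (cases w) auto
  ultimately show False
    using assms(1) unfolding undirected_tree_def by blast
qed

section \<open>Choosing the label of one new vertex\<close>

text \<open>Only \<open>x\<close> and \<open>p\<close> can become settled. The first summand of the
  bound on \<open>k\<close> counts labels excluded by the sum of \<open>x\<close>, the second those
  excluded by the sum of \<open>p\<close>.\<close>

lemma label_step:
  assumes tree: "undirected_tree G" and n: "3 \<le> card (verts G)"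
    and S: "joined G S" "S \<subseteq> verts G" "p \<in> S" "x \<notin> S" "p \<rightarrow> x"
    and f: "range f \<subseteq> {1..k}" "inj_on (vertex_sum G f) (settled G S)"
    and k: "card (settled G S) + card (settled G S - leaves_at G p) < k"
  obtains a where "a \<in> {1..k}" "inj_on (vertex_sum G (f(x := a))) (settled G (insert x S))"
proof -
  let ?D = "settled G S" and ?E = "settled G S - leaves_at G p"
  let ?s = "vertex_sum G f"
  define r where "r = sum f (closed_nbhd G p - {x})"
  \<comment> \<open>With label \<open>a\<close> on \<open>x\<close>, the sum of \<open>p\<close> is
    \<open>a + r\<close>, and that of \<open>x\<close>, once settled, is \<open>a + f p\<close>. The
    sets collect the \<open>a\<close> for which one of these equals an old sum; truncated
    differences do no harm, since only the number of excluded labels matters.\<close>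
  define bad where "bad = (\<lambda>w. ?s w - f p) ` ?D \<union> (\<lambda>w. ?s w - r) ` ?E"
  have fin: "finite ?D"
    using settled_subset S(2) finite_verts by (meson finite_subset)
  have "card bad \<le> card ?D + card ?E"
    unfolding bad_def using fin
    by (meson card_Un_le card_image_le add_mono finite_Diff le_trans)
  then have "\<not> {1..k} \<subseteq> bad"
    using k card_mono[of bad "{1..k}"] fin by (auto simp: bad_def)
  then obtain a where a: "a \<in> {1..k}" "a \<notin> bad"
    by blast
  let ?t = "vertex_sum G (f(x := a))"
  have pos: "0 < (f(x := a)) v" for v
    using a(1) f(1) by (auto simp: image_subset_iff Suc_le_eq)
  have old: "?t v = ?s v" if "v \<in> ?D" for v
    unfolding vertex_sum_def using that S(4) by (intro sum.cong) (auto simp: settled_def)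
  have "x \<noteq> p" using S by blast
  have xp: "x \<in> closed_nbhd G p"
    using S by (simp add: mem_closed_nbhd_iff)
  have only: "v = p" if "v \<in> S" "x \<rightarrow> v" for v
    using unique_neighbour_in_joined[OF tree S(1,4) that(1) S(3) that(2)] S(5) adj_sym by blast
  \<comment> \<open>A newly settled vertex has \<open>x\<close> in its closed neighbourhood, so it
    is \<open>x\<close> or the only neighbour of \<open>x\<close> in \<open>S\<close>.\<close>
  have new: "settled G (insert x S) \<subseteq> ?D \<union> {x, p}"
  proof
    fix v assume v: "v \<in> settled G (insert x S)"
    show "v \<in> ?D \<union> {x, p}"
    proof (cases "x \<in> closed_nbhd G v")
      case True
      then have "v = x \<or> x \<rightarrow> v"
        by (metis adj_sym mem_closed_nbhd_iff)
      moreover have "v \<in> insert x S"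
        by (rule subsetD[OF settled_subset v])
      ultimately show ?thesis
        using only by blast
    next
      case False
      then show ?thesis
        using v by (auto simp: settled_def)
    qed
  qed
  have nx: "closed_nbhd G x = {x, p}" if "x \<in> settled G (insert x S)"
    using that only adj_sym[OF S(5)] adj_irrefl by (auto simp: settled_def closed_nbhd_def)
  have tx: "?t x = a + f p" if "x \<in> settled G (insert x S)"
    using nx[OF that] \<open>x \<noteq> p\<close> by (simp add: vertex_sum_def)
  have tp: "?t p = a + r"
  proof -
    have "sum (f(x := a)) (closed_nbhd G p - {x}) = r"
      unfolding r_def by (intro sum.cong) auto
    then show ?thesis
      unfolding vertex_sum_def using sum.remove[OF finite_closed_nbhd xp, of "f(x := a)"] by simp
  qed
  have sep_x: "?t x \<noteq> ?t v" if "x \<in> settled G (insert x S)" "v \<in> ?D" for v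
  proof
    assume "?t x = ?t v"
    then have "a = ?s v - f p"
      using tx that old by simp
    then show False
      using a(2) that(2) unfolding bad_def by blast
  qed
  \<comment> \<open>A settled leaf \<open>v\<close> at \<open>p\<close> has closed neighbourhood
    \<open>{v, p}\<close>, a proper part of that of \<open>p\<close>, which also contains
    \<open>x\<close>. This is why \<open>?E\<close> omits the leaves.\<close>
  have sep_p: "?t p \<noteq> ?t v" if "v \<in> ?D" for v
  proof (cases "v \<in> leaves_at G p")
    case True
    then have "closed_nbhd G v \<subseteq> closed_nbhd G p"
      using closed_nbhd_leaf[OF True] by (auto simp: leaves_at_def mem_closed_nbhd_iff)
    moreover have "x \<notin> closed_nbhd G v"
      using that S(4) by (auto simp: settled_def)
    ultimately have "?t v < ?t p"
      using xp pos by (intro vertex_sum_less) auto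
    then show ?thesis by simp
  next
    case False
    show ?thesis
    proof
      assume "?t p = ?t v"
      then have "a = ?s v - r"
        using tp that old by simp
      then show False
        using a(2) that False unfolding bad_def by blast
    qed
  qed
  have sep_xp: "?t x < ?t p" if "x \<in> settled G (insert x S)"
  proof (rule vertex_sum_less)
    \<comment> \<open>Otherwise \<open>{x, p}\<close> would be closed under adjacency and exhaust
      the tree, against \<open>n\<close>.\<close>
    have "closed_nbhd G p \<noteq> {x, p}"
    proof
      assume *: "closed_nbhd G p = {x, p}"
      have "verts G \<subseteq> {x, p}"
      proof (rule verts_subset_if_closed)
        show "connected G"
          using tree by (simp add: undirected_tree_def)
        show "p \<in> verts G" using S by blast
        show "w \<in> {x, p}" if "v \<in> {x, p}" "v \<rightarrow> w" for v w
          using that * nx[OF \<open>x \<in> settled G (insert x S)\<close>] mem_closed_nbhd_iff[of w G v] by auto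
      qed simp
      then have "card (verts G) \<le> card {x, p}"
        by (intro card_mono) auto
      then show False
        using n card_insert_le_m1[of 2 "{p}" x] by simp
    qed
    then show "closed_nbhd G x \<subset> closed_nbhd G p"
      unfolding nx[OF that] using xp by (simp add: psubset_eq mem_closed_nbhd_iff eq_commute)
  qed (rule pos)
  have "inj_on ?t (settled G (insert x S))"
  proof (rule inj_onI)
    fix v w assume vw: "v \<in> settled G (insert x S)" "w \<in> settled G (insert x S)" "?t v = ?t w"
    then have "v \<in> ?D \<or> v = x \<or> v = p" "w \<in> ?D \<or> w = x \<or> w = p"
      using new by blast+
    moreover have "v = w" if "v \<in> ?D" "w \<in> ?D"
      using that vw(3) old f(2) by (simp add: inj_on_def)
    ultimately show "v = w"
      using vw sep_x sep_p sep_xp by (metis less_irrefl)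
  qed
  with a(1) show thesis
    by (rule that)
qed

section \<open>The order of labelling and the upper bound\<close>

text \<open>The last assumption encodes two phases: either no leaf at \<open>u\<close> has been
  labelled, or only such leaves remain.\<close>

lemma ex_edge_leaving:
  assumes "connected G" "u \<in> verts G" "u \<in> S" "S \<subset> verts G"
    and "S \<inter> leaves_at G u = {} \<or> verts G \<subseteq> S \<union> leaves_at G u"
  obtains (inner) p x where "p \<in> S" "x \<notin> S" "p \<rightarrow> x" "x \<notin> leaves_at G u" "S \<inter> leaves_at G u = {}"
  | (leaf) x where "x \<notin> S" "u \<rightarrow> x" "verts G \<subseteq> S \<union> leaves_at G u"
proof (cases "verts G \<subseteq> S \<union> leaves_at G u")
  case True
  then obtain x where "x \<in> leaves_at G u" "x \<notin> S"
    using assms(4) by blast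
  then show thesis
    using True by (intro leaf) (auto simp: leaves_at_def)
next
  case False
  then obtain v w where vw: "v \<in> S \<union> leaves_at G u" "v \<rightarrow> w" "w \<notin> S \<union> leaves_at G u"
    using verts_subset_if_closed[of u "S \<union> leaves_at G u"] assms(1-3) by blast
  \<comment> \<open>A leaf at \<open>u\<close> has \<open>u\<close> as its only neighbour, and
    \<open>u\<close> is in \<open>S\<close>, so the edge cannot start at a leaf.\<close>
  then have "v \<in> S"
    using assms(3) by (auto simp: adj_leaf_iff)
  then show thesis
    using vw False assms(5) by (intro inner[of v w]) auto
qed

text \<open>Induction on the number \<open>m\<close> of labelled vertices. Vertices outside
  \<open>S\<close> carry placeholder labels in \<open>{1..k}\<close>, which no settled sum sees and
  which keep \<open>f\<close> positive everywhere.\<close>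

lemma ex_greedy_labelling:
  assumes tree: "undirected_tree G" and n: "3 \<le> card (verts G)" and u: "u \<in> verts G"
    and m: "1 \<le> m" "m \<le> card (verts G)"
    and k: "k = 2 * card (verts G) - 2 - card (leaves_at G u)"
  shows "\<exists>S f. joined G S \<and> u \<in> S \<and> S \<subseteq> verts G \<and> card S = m
    \<and> (S \<inter> leaves_at G u = {} \<or> verts G \<subseteq> S \<union> leaves_at G u)
    \<and> range f \<subseteq> {1..k} \<and> inj_on (vertex_sum G f) (settled G S)"
  using m
proof (induction m rule: dec_induct)
  let ?L = "leaves_at G u"
  have L: "card ?L + 1 \<le> card (verts G)"
  proof -
    have "card (insert u ?L) \<le> card (verts G)"
      using u by (intro card_mono) (auto simp: leaves_at_def)
    then show ?thesis
      using vertex_not_in_leaves_at finite_leaves_at by simp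
  qed
  {
    case base
    have "settled G {u} \<subseteq> {u}"
      by (rule settled_subset)
    then have "inj_on (vertex_sum G (\<lambda>_. 1)) (settled G {u})"
      by (auto simp: inj_on_def)
    moreover have "range (\<lambda>_::'a. 1::nat) \<subseteq> {1..k}"
      using k n L by auto
    ultimately show ?case
      using u joined_singleton vertex_not_in_leaves_at
      by (intro exI[of _ "{u}"] exI[of _ "\<lambda>_. 1"]) auto
  next
    case (step m)
    then obtain S f where S: "joined G S" "u \<in> S" "S \<subseteq> verts G" "card S = m"
        "S \<inter> ?L = {} \<or> verts G \<subseteq> S \<union> ?L"
      and f: "range f \<subseteq> {1..k}" "inj_on (vertex_sum G f) (settled G S)"
      by auto
    have finS: "finite S"
      using S(3) finite_verts finite_subset by blast
    have finL: "finite ?L"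
      by (rule finite_leaves_at)
    have "S \<subset> verts G"
      using S step.prems by auto
    \<comment> \<open>The saved 1 comes from \<open>p\<close>, which is unsettled while its
      neighbour \<open>x\<close> lies outside \<open>S\<close>.\<close>
    have card_settled: "card (settled G S) \<le> m - 1" if "p \<in> S" "x \<notin> S" "p \<rightarrow> x" for p x
    proof -
      have "settled G S \<subseteq> S - {p}"
        using settled_subset[of G S] that by (auto simp: settled_def closed_nbhd_def)
      then have "card (settled G S) \<le> card (S - {p})"
        using finS by (intro card_mono) auto
      then show ?thesis
        using that S(4) by simp
    qed
    have goal: ?case
      if px: "p \<in> S" "x \<notin> S" "p \<rightarrow> x"
        and disj: "insert x S \<inter> ?L = {} \<or> verts G \<subseteq> insert x S \<union> ?L"
        and less: "card (settled G S) + card (settled G S - leaves_at G p) < k" for p x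
    proof -
      obtain a where a: "a \<in> {1..k}" "inj_on (vertex_sum G (f(x := a))) (settled G (insert x S))"
        using label_step[OF tree n S(1,3) px f less] by blast
      have "range (f(x := a)) \<subseteq> {1..k}"
        using a(1) f(1) by auto
      moreover have "x \<in> verts G"
        using px(3) by auto
      ultimately show ?thesis
        using a(2) disj S joined_insert[OF S(1) px] px(2) finS
        by (intro exI[of _ "insert x S"] exI[of _ "f(x := a)"]) (auto simp del: fun_upd_apply)
    qed
    have conn: "connected G"
      using tree by (simp add: undirected_tree_def)
    show ?case
    proof (rule ex_edge_leaving[OF conn u S(2) \<open>S \<subset> verts G\<close> S(5)])
      fix p x assume px: "p \<in> S" "x \<notin> S" "p \<rightarrow> x" "x \<notin> ?L" "S \<inter> ?L = {}"
      have "card (insert x S \<union> ?L) \<le> card (verts G)"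
        using px(3) S(3) by (intro card_mono) (auto simp: leaves_at_def)
      \<comment> \<open>All leaves at \<open>u\<close> and \<open>x\<close> are still unlabelled, so
        even twice the bound \<open>m - 1\<close> stays below \<open>k\<close>.\<close>
      then have "m + 1 + card ?L \<le> card (verts G)"
        using px finS finL S(4) by (simp add: card_Un_disjoint)
      moreover have "card (settled G S - leaves_at G p) \<le> card (settled G S)"
        using finite_subset[OF settled_subset finS] by (intro card_mono) auto
      ultimately have "card (settled G S) + card (settled G S - leaves_at G p) < k"
        using card_settled[OF px(1-3)] k step.hyps by linarith
      then show ?case
        using px by (intro goal[of p x]) auto
    next
      fix x assume x: "x \<notin> S" "u \<rightarrow> x" "verts G \<subseteq> S \<union> ?L"
      \<comment> \<open>Here \<open>p\<close> is \<open>u\<close>: at most \<open>n - 2\<close>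
        vertices are settled, and at most \<open>n - 1 - card ?L\<close> of them are not leaves at
        \<open>u\<close>, where \<open>n\<close> is the order of the tree. The total is at most
        \<open>k - 1\<close>.\<close>
      have "u \<notin> settled G S"
        using x by (auto simp: settled_def closed_nbhd_def)
      then have "settled G S - ?L \<subseteq> verts G - insert u ?L"
        using settled_subset[of G S] S(3) by blast
      then have "card (settled G S - ?L) \<le> card (verts G - insert u ?L)"
        by (intro card_mono) auto
      also have "\<dots> = card (verts G) - (card ?L + 1)"
        using u finL vertex_not_in_leaves_at
        by (subst card_Diff_subset) (auto simp: leaves_at_def)
      finally have "card (settled G S) + card (settled G S - ?L) < k"
        using card_settled[OF S(2) x(1,2)] k L step.hyps step.prems by linarith
      then show ?case
        using x S(2) by (intro goal[of u x]) auto
    qed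
  }
qed

text \<open>Once all vertices are labelled they are all settled, so all sums are pairwise
  distinct.\<close>

lemma vertex_sum_number_le:
  assumes "undirected_tree G" "3 \<le> card (verts G)" "u \<in> verts G"
  shows "vertex_sum_number G \<le> 2 * card (verts G) - 2 - card (leaves_at G u)" (is "_ \<le> ?k")
proof -
  have "1 \<le> card (verts G)"
    using assms(2) by simp
  then obtain S f where S: "S \<subseteq> verts G" "card S = card (verts G)"
    and f: "range f \<subseteq> {1..?k}" "inj_on (vertex_sum G f) (settled G S)"
    using ex_greedy_labelling[OF assms _ order.refl refl] by blast
  have "S = verts G"
    using S finite_verts by (simp add: card_subset_eq)
  then have "inj_on (vertex_sum G f) (verts G)"
    using f(2) settled_verts by simp
  then have "vertex_sum_distinguishing G f"
    unfolding vertex_sum_distinguishing_def by (metis inj_on_eq_iff)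
  moreover have "f ` verts G \<subseteq> {1..?k}"
    using f(1) by blast
  ultimately show ?thesis
    unfolding vertex_sum_number_def by (intro Least_le) blast
qed

section \<open>The lower bound and stars\<close>

text \<open>The sum of a leaf \<open>v\<close> at \<open>u\<close> is \<open>f v + f u\<close>, so
  equal labels on two such leaves would give equal sums.\<close>

lemma card_leaves_at_le_vertex_sum_number:
  "card (leaves_at G u) \<le> vertex_sum_number G"
proof -
  have "\<exists>k f. f ` verts G \<subseteq> {1..k} \<and> vertex_sum_distinguishing G f"
    by (rule ex_vertex_sum_distinguishing) unfold_locales
  from LeastI_ex[OF this] obtain f
    where f: "f ` verts G \<subseteq> {1..vertex_sum_number G}" "vertex_sum_distinguishing G f"
    unfolding vertex_sum_number_def by blast
  have "inj_on f (leaves_at G u)"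
  proof (rule inj_onI, rule ccontr)
    fix v w assume vw: "v \<in> leaves_at G u" "w \<in> leaves_at G u" "f v = f w" "v \<noteq> w"
    then have "v \<noteq> u" "w \<noteq> u"
      using vertex_not_in_leaves_at by auto
    then have "vertex_sum G f v = vertex_sum G f w" "closed_nbhd G v \<noteq> closed_nbhd G w"
      using vw by (auto simp: vertex_sum_def closed_nbhd_leaf)
    then show False
      using f(2) vw(1,2) by (auto simp: vertex_sum_distinguishing_def leaves_at_def)
  qed
  moreover have "f ` leaves_at G u \<subseteq> {1..vertex_sum_number G}"
    using f(1) by (auto simp: leaves_at_def)
  ultimately have "card (leaves_at G u) \<le> card {1..vertex_sum_number G}"
    by (intro card_inj_on_le) auto
  then show ?thesis by simp
qed

end

text \<open>The centre is the vertex of the singleton side; each vertex of the other side has it as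
  its only neighbour.\<close>

lemma star_center:
  assumes "star G"
  obtains c where "c \<in> verts G" "card (leaves_at G c) = card (verts G) - 1"
proof -
  obtain m U V where G: "graph G" "verts G = U \<union> V" "U \<inter> V = {}" "card U = 1"
    "arcs_ends G = U \<times> V \<union> V \<times> U"
    using assms by (auto simp: star_def complete_bipartite_digraph_def)
  interpret graph G by (fact G(1))
  obtain c where c: "U = {c}"
    using G(4) card_1_singletonE by blast
  have "{w. v \<rightarrow>\<^bsub>G\<^esub> w} = {c}" if "v \<in> V" for v
    using that G c by auto
  then have "leaves_at G c = V"
    using G c by (auto simp: leaves_at_def out_degree_conv_adj)
  moreover have "V = verts G - {c}"
    using G c by auto
  moreover have "c \<in> verts G"
    using G c by auto
  ultimately show thesis
    by (intro that[of c]) (simp_all add: card_Diff_singleton)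
qed

theorem theorem4:
  fixes T :: "('a, 'b) pre_digraph" and n :: nat
  assumes "undirected_tree T"
    and "card (verts T) = n"
    and "n \<ge> 3"
  shows "int (vertex_sum_number T) \<le> 2 * int n - 2 - int (max_leaves_at T)
    \<and> (star T \<longrightarrow> int (vertex_sum_number T) = 2 * int n - 2 - int (max_leaves_at T))"
proof -
  interpret graph T
    using assms(1) by (simp add: undirected_tree_def)
  let ?d = "\<lambda>u. card (leaves_at T u)"
  have "verts T \<noteq> {}"
    using assms by auto
  then have "max_leaves_at T \<in> ?d ` verts T"
    unfolding max_leaves_at_def by (intro Max_in) auto
  then obtain u where u: "u \<in> verts T" "max_leaves_at T = ?d u"
    by blast
  \<comment> \<open>This keeps the natural-number subtraction in the upper bound from
    truncating.\<close>
  have "?d u \<le> n"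
    using card_mono[of "verts T" "leaves_at T u"] assms(2) by (auto simp: leaves_at_def)
  then have upper: "int (vertex_sum_number T) \<le> 2 * int n - 2 - int (max_leaves_at T)"
    using vertex_sum_number_le[OF assms(1) _ u(1)] assms(2,3) u(2) by auto
  moreover have "int (vertex_sum_number T) = 2 * int n - 2 - int (max_leaves_at T)" if "star T"
  proof -
    obtain c where c: "c \<in> verts T" "?d c = n - 1"
      using star_center[OF \<open>star T\<close>] assms(2) by metis
    \<comment> \<open>With at least \<open>n - 1\<close> leaves at the centre the upper bound is at
      most \<open>n - 1\<close>, which meets the lower bound.\<close>
    then have "n - 1 \<le> max_leaves_at T"
      unfolding max_leaves_at_def by (metis Max_ge finite_imageI finite_verts image_eqI)
    moreover have "n - 1 \<le> vertex_sum_number T"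
      using card_leaves_at_le_vertex_sum_number[of c] c(2) by simp
    ultimately show ?thesis
      using upper assms(3) by linarith
  qed
  ultimately show ?thesis
    by blast
qed

end
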